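(* Let $f$ be a smooth real-valued function on the Riemannian manifold $(Gl(2n,\mathbb{R}),\langle\cdot,\cdot\rangle_{Inv})$, and let $X,Y$ be two left invariant vector fields on $Gl(2n,\mathbb{R})$, i.e. $X_M=MX_0$, $Y_M=MY_0$ with $X_0,Y_0\in\mathcal{M}_{2n}(\mathbb{R})$. Then at every $M\in Gl(2n,\mathbb{R})$ $$\mathrm{Hess}_{Inv}f(MX_0,MY_0)=\mathrm{Hess}_{Euc}f(MX_0,MY_0)+\left\langle\nabla_{Euc}f(M),MZ_{(X_0,Y_0)}\right\rangle_{Euc},$$ where $$Z_{(X_0,Y_0)}=\frac{1}{2}\left(X_0Y_0+Y_0X_0+[Y_0^T,X_0]+[X_0^T,Y_0]\right).$$
   Context: $\mathcal{M}_{2n}(\mathbb{R})$ is the space of real $2n\times 2n$ matrices with the Frobenius inner product $\langle X,Y\rangle_{Euc}=\mathrm{tr}(X^TY)$, and $Gl(2n,\mathbb{R})$ is its open subset of invertible matrices. $\nabla_{Euc}f(M)$ is the gradient with respect to $\langle\cdot,\cdot\rangle_{Euc}$ and $\mathrm{Hess}_{Euc}f$ is the ordinary second derivative of $f$ at $M$ as a bilinear form. The left invariant metric is $\langle X_M,Y_M\rangle_{Inv}=\mathrm{tr}(X_M^TM^{-T}M^{-1}Y_M)$ for $X_M,Y_M\in T_MGl(2n,\mathbb{R})$, and $\mathrm{Hess}_{Inv}f(X,Y)=X(Yf)-(\nabla^{Inv}_XY)f$ is the Riemannian Hessian, with $\nabla^{Inv}$ the Levi-Civita connection of $\langle\cdot,\cdot\rangle_{Inv}$.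 All Hessians are evaluated at the point $M$. $[X,Y]=XY-YX$ is the matrix commutator. *)

theory Defs
  imports "HOL-Analysis.Analysis"
begin

text \<open>
  Calculus on an open subset \<open>U\<close> of a Euclidean space. Vector fields on \<open>U\<close> are functions
  \<open>'a \<Rightarrow> 'a\<close>, all tangent spaces being identified with \<open>'a\<close>; values outside \<open>U\<close> are irrelevant.
\<close>

primrec Ck_on :: "nat \<Rightarrow> 'a set \<Rightarrow> ('a::euclidean_space \<Rightarrow> 'b::real_normed_vector) \<Rightarrow> bool" where
  "Ck_on 0 U F \<longleftrightarrow> continuous_on U F"
| "Ck_on (Suc k) U F \<longleftrightarrow>
     (\<forall>p\<in>U. F differentiable (at p)) \<and>
     (\<forall>v. Ck_on k U (\<lambda>p. frechet_derivative F (at p) v))"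

definition smooth_on :: "'a set \<Rightarrow> ('a::euclidean_space \<Rightarrow> 'b::real_normed_vector) \<Rightarrow> bool" where
  "smooth_on U F \<longleftrightarrow> (\<forall>k. Ck_on k U F)"

definition deriv_along ::
    "('a::euclidean_space \<Rightarrow> 'a) \<Rightarrow> ('a \<Rightarrow> 'b::real_normed_vector) \<Rightarrow> 'a \<Rightarrow> 'b" where
  "deriv_along X F p = frechet_derivative F (at p) (X p)"

definition lie_bracket :: "('a::euclidean_space \<Rightarrow> 'a) \<Rightarrow> ('a \<Rightarrow> 'a) \<Rightarrow> 'a \<Rightarrow> 'a" where
  "lie_bracket X Y p = deriv_along X Y p - deriv_along Y X p"

text \<open>
  A connection is read as an operator \<open>D\<close> on vector fields, constrained only for smooth fields and
  at points of \<open>U\<close>. Real homogeneity in the second argument is the Leibniz rule for constant \<open>h\<close>.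
\<close>

definition affine_connection_on ::
    "'a set \<Rightarrow> (('a::euclidean_space \<Rightarrow> 'a) \<Rightarrow> ('a \<Rightarrow> 'a) \<Rightarrow> 'a \<Rightarrow> 'a) \<Rightarrow> bool" where
  "affine_connection_on U D \<longleftrightarrow>
     (\<forall>X Y. smooth_on U X \<longrightarrow> smooth_on U Y \<longrightarrow> smooth_on U (D X Y)) \<and>
     (\<forall>X X' Y. smooth_on U X \<longrightarrow> smooth_on U X' \<longrightarrow> smooth_on U Y \<longrightarrow>
        (\<forall>p\<in>U. D (\<lambda>q. X q + X' q) Y p = D X Y p + D X' Y p)) \<and>
     (\<forall>h X Y. smooth_on U h \<longrightarrow> smooth_on U X \<longrightarrow> smooth_on U Y \<longrightarrow>
        (\<forall>p\<in>U. D (\<lambda>q. h q *\<^sub>R X q) Y p = h p *\<^sub>R D X Y p)) \<and>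
     (\<forall>X Y Y'. smooth_on U X \<longrightarrow> smooth_on U Y \<longrightarrow> smooth_on U Y' \<longrightarrow>
        (\<forall>p\<in>U. D X (\<lambda>q. Y q + Y' q) p = D X Y p + D X Y' p)) \<and>
     (\<forall>h X Y. smooth_on U h \<longrightarrow> smooth_on U X \<longrightarrow> smooth_on U Y \<longrightarrow>
        (\<forall>p\<in>U. D X (\<lambda>q. h q *\<^sub>R Y q) p = deriv_along X h p *\<^sub>R Y p + h p *\<^sub>R D X Y p))"

definition levi_civita_connection ::
    "'a set \<Rightarrow> ('a \<Rightarrow> 'a \<Rightarrow> 'a \<Rightarrow> real) \<Rightarrow>
      (('a::euclidean_space \<Rightarrow> 'a) \<Rightarrow> ('a \<Rightarrow> 'a) \<Rightarrow> 'a \<Rightarrow> 'a) \<Rightarrow> bool" where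
  "levi_civita_connection U g D \<longleftrightarrow>
     affine_connection_on U D \<and>
     (\<forall>X Y. smooth_on U X \<longrightarrow> smooth_on U Y \<longrightarrow>
        (\<forall>p\<in>U. D X Y p - D Y X p = lie_bracket X Y p)) \<and>
     (\<forall>X Y Z. smooth_on U X \<longrightarrow> smooth_on U Y \<longrightarrow> smooth_on U Z \<longrightarrow>
        (\<forall>p\<in>U. deriv_along X (\<lambda>q. g q (Y q) (Z q)) p = g p (D X Y p) (Z p) + g p (Y p) (D X Z p)))"

definition hessian ::
    "(('a::euclidean_space \<Rightarrow> 'a) \<Rightarrow> ('a \<Rightarrow> 'a) \<Rightarrow> 'a \<Rightarrow> 'a) \<Rightarrow>
      ('a \<Rightarrow> real) \<Rightarrow> ('a \<Rightarrow> 'a) \<Rightarrow> ('a \<Rightarrow> 'a) \<Rightarrow> 'a \<Rightarrow> real" where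
  "hessian D f X Y p = deriv_along X (deriv_along Y f) p - deriv_along (D X Y) f p"

definition euc_hessian :: "('a::euclidean_space \<Rightarrow> real) \<Rightarrow> 'a \<Rightarrow> 'a \<Rightarrow> 'a \<Rightarrow> real" where
  "euc_hessian f p v w = frechet_derivative (\<lambda>q. frechet_derivative f (at q) w) (at p) v"

definition GL :: "(real^'m^'m) set" where
  "GL = {M. invertible M}"

definition frobenius_inner :: "real^'m^'m \<Rightarrow> real^'m^'m \<Rightarrow> real" where
  "frobenius_inner X Y = trace (transpose X ** Y)"

text \<open>The norm of \<open>real^'m^'m\<close>, with respect to which derivatives are taken, is the Frobenius norm.\<close>

lemma frobenius_inner_eq_inner: "frobenius_inner X Y = X \<bullet> Y"
  unfolding frobenius_inner_def trace_def matrix_matrix_mult_def transpose_def inner_vec_def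
  by (simp, rule sum.swap)

definition euc_gradient :: "(real^'m^'m \<Rightarrow> real) \<Rightarrow> real^'m^'m \<Rightarrow> real^'m^'m" where
  "euc_gradient f M = (THE G. (f has_derivative frobenius_inner G) (at M))"

definition inv_metric :: "real^'m^'m \<Rightarrow> real^'m^'m \<Rightarrow> real^'m^'m \<Rightarrow> real" where
  "inv_metric M X Y =
     trace (transpose X ** transpose (matrix_inv M) ** matrix_inv M ** Y)"

definition left_invariant_field :: "real^'m^'m \<Rightarrow> real^'m^'m \<Rightarrow> real^'m^'m" where
  "left_invariant_field X\<^sub>0 M = M ** X\<^sub>0"

definition commutator :: "real^'m^'m \<Rightarrow> real^'m^'m \<Rightarrow> real^'m^'m" where
  "commutator A B = A ** B - B ** A"

definition Z_matrix :: "real^'m^'m \<Rightarrow> real^'m^'m \<Rightarrow> real^'m^'m" where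
  "Z_matrix X\<^sub>0 Y\<^sub>0 = (1/2) *\<^sub>R
     (X\<^sub>0 ** Y\<^sub>0 + Y\<^sub>0 ** X\<^sub>0 + commutator (transpose Y\<^sub>0) X\<^sub>0 + commutator (transpose X\<^sub>0) Y\<^sub>0)"

end

(* For left invariant fields the metric coefficients are constant, so Koszul's formula is purely
   algebraic and determines the covariant derivative:
   2 D_X Y = M ([X0,Y0] - [Y0^T,X0] - [X0^T,Y0]).  On the other hand X (Y f) is the Euclidean
   Hessian plus df (M X0 Y0), and subtracting df (D_X Y) gives the formula. *)
theory Submission
  imports Defs
begin

section \<open>Smooth functions and iterated directional derivatives\<close>

lemma Ck_on_const: "Ck_on k U (\<lambda>p. c)"
  by (induction k arbitrary: c) auto

text \<open>The derivative of \<open>F\<close> at every point is \<open>F\<close> itself, so each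
  directional derivative is constant in \<open>p\<close>. A case split on \<open>k\<close> therefore
  replaces an induction.\<close>

lemma smooth_on_bounded_linear:
  assumes "bounded_linear F"
  shows "smooth_on U F"
  unfolding smooth_on_def
proof
  fix k
  have "frechet_derivative F (at p) = F" for p
    using frechet_derivative_at[OF bounded_linear_imp_has_derivative[OF assms]] by metis
  moreover have "F differentiable (at p)" for p
    using assms by (rule bounded_linear_imp_differentiable)
  moreover have "continuous_on U F"
    using assms by (simp add: linear_continuous_on)
  ultimately show "Ck_on k U F"
    by (cases k) (simp_all add: Ck_on_const)
qed

lemma smooth_on_imp_differentiable:
  assumes "smooth_on U F" "p \<in> U"
  shows "F differentiable (at p)"
proof -
  have "Ck_on (Suc 0) U F"
    using assms(1) unfolding smooth_on_def by blast
  then show ?thesis using assms(2) by simp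
qed

lemma smooth_on_frechet_derivative:
  assumes "smooth_on U F"
  shows "smooth_on U (\<lambda>p. frechet_derivative F (at p) v)"
  unfolding smooth_on_def
proof
  fix k
  have "Ck_on (Suc k) U F"
    using assms unfolding smooth_on_def by blast
  then show "Ck_on k U (\<lambda>p. frechet_derivative F (at p) v)" by simp
qed

lemma smooth_on_imp_has_derivative:
  assumes "smooth_on U F" "p \<in> U"
  shows "(F has_derivative frechet_derivative F (at p)) (at p)"
  using smooth_on_imp_differentiable[OF assms] frechet_derivative_works by blast

text \<open>Smoothness controls derivatives of \<open>f\<close> only in a fixed direction, whereas
  along a vector field the direction moves with the point. Expanding in the basis leaves fixed
  directions with varying scalar coefficients.\<close>

lemma frechet_derivative_expand:
  fixes v :: "'a::euclidean_space"
  assumes "smooth_on U f" "q \<in> U"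
  shows "frechet_derivative f (at q) v = (\<Sum>b\<in>Basis. (v \<bullet> b) *\<^sub>R frechet_derivative f (at q) b)"
proof -
  have "linear (frechet_derivative f (at q))"
    using smooth_on_imp_has_derivative[OF assms] has_derivative_linear by blast
  then have "frechet_derivative f (at q) (\<Sum>b\<in>Basis. (v \<bullet> b) *\<^sub>R b)
      = (\<Sum>b\<in>Basis. (v \<bullet> b) *\<^sub>R frechet_derivative f (at q) b)"
    by (simp add: linear_sum linear_cmul)
  then show ?thesis by (simp add: euclidean_representation)
qed

text \<open>A product rule: one term differentiates df with the direction frozen at
  \<open>Y p\<close>, the other differentiates the direction.\<close>

lemma has_derivative_frechet_derivative_along:
  fixes f :: "'a::euclidean_space \<Rightarrow> real"
  assumes U: "open U" "p \<in> U" and f: "smooth_on U f" and Y: "(Y has_derivative Y') (at p)"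
  shows "((\<lambda>q. frechet_derivative f (at q) (Y q)) has_derivative
           (\<lambda>v. euc_hessian f p v (Y p) + frechet_derivative f (at p) (Y' v))) (at p)"
proof -
  define H where "H b q = frechet_derivative f (at q) b" for b q
  define H' where "H' b = frechet_derivative (H b) (at p)" for b
  have H: "(H b has_derivative H' b) (at p)" for b
    using smooth_on_imp_has_derivative[OF smooth_on_frechet_derivative[OF f] U(2)]
    unfolding H_def H'_def .
  \<comment> \<open>Kept general in \<open>W\<close> because it serves twice: for \<open>Y\<close>,
    and for a constant field, which identifies the second-order terms.\<close>
  have sum: "((\<lambda>q. frechet_derivative f (at q) (W q)) has_derivative
      (\<lambda>v. \<Sum>b\<in>Basis. (W p \<bullet> b) * H' b v + (W' v \<bullet> b) * H b p)) (at p)"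
    if W: "(W has_derivative W') (at p)" for W W'
  proof -
    have "((\<lambda>q. \<Sum>b\<in>Basis. (W q \<bullet> b) * H b q) has_derivative
        (\<lambda>v. \<Sum>b\<in>Basis. (W p \<bullet> b) * H' b v + (W' v \<bullet> b) * H b p)) (at p)"
      by (intro has_derivative_sum has_derivative_mult has_derivative_inner_left W H)
    then show ?thesis
      by (rule has_derivative_transform_within_open[OF _ U])
        (simp add: frechet_derivative_expand[OF f, of _ "W _"] H_def)
  qed
  \<comment> \<open>For the constant field \<open>w\<close> the derivative \<open>W'\<close> is
    zero, so only the second-order terms survive.\<close>
  have "euc_hessian f p v w = (\<Sum>b\<in>Basis. (w \<bullet> b) * H' b v)" for v w
    using frechet_derivative_at[OF sum[OF has_derivative_const[of w]], symmetric]
    unfolding euc_hessian_def by simp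
  moreover have "frechet_derivative f (at p) w = (\<Sum>b\<in>Basis. (w \<bullet> b) * H b p)" for w
    using frechet_derivative_expand[OF f U(2), of w] by (simp add: H_def)
  ultimately show ?thesis
    using sum[OF Y] by (simp add: sum.distrib)
qed

lemma deriv_along_deriv_along:
  fixes f :: "'a::euclidean_space \<Rightarrow> real"
  assumes "open U" "p \<in> U" "smooth_on U f" "(Y has_derivative Y') (at p)"
  shows "deriv_along X (deriv_along Y f) p =
    euc_hessian f p (X p) (Y p) + frechet_derivative f (at p) (Y' (X p))"
proof -
  have "deriv_along Y f = (\<lambda>q. frechet_derivative f (at q) (Y q))"
    by (simp add: deriv_along_def fun_eq_iff)
  then show ?thesis
    using frechet_derivative_at[OF has_derivative_frechet_derivative_along[OF assms], symmetric]
    by (simp add: deriv_along_def[of X])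
qed

section \<open>The Euclidean gradient\<close>

lemma frobenius_inner_euc_gradient:
  assumes "f differentiable (at M)"
  shows "frobenius_inner (euc_gradient f M) V = frechet_derivative f (at M) V"
proof -
  let ?f' = "frechet_derivative f (at M)"
  \<comment> \<open>The Riesz vector of \<open>?f'\<close>: its coordinates are the values of
    \<open>?f'\<close> on the orthonormal basis.\<close>
  define G where "G = (\<Sum>b\<in>Basis. ?f' b *\<^sub>R b)"
  have d: "(f has_derivative ?f') (at M)"
    using assms frechet_derivative_works by blast
  have "linear ?f'"
    using d has_derivative_linear by blast
  have "?f' V = frobenius_inner G V" for V
  proof -
    have "?f' V = ?f' (\<Sum>b\<in>Basis. (V \<bullet> b) *\<^sub>R b)"
      by (simp only: euclidean_representation)
    also have "\<dots> = (\<Sum>b\<in>Basis. (V \<bullet> b) * ?f' b)"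
      using \<open>linear ?f'\<close> by (simp add: linear_sum linear_cmul)
    also have "\<dots> = G \<bullet> V"
      unfolding G_def inner_sum_left by (simp add: inner_commute mult.commute)
    finally show ?thesis by (simp only: frobenius_inner_eq_inner)
  qed
  then have G: "?f' = frobenius_inner G" by blast
  \<comment> \<open>Uniqueness, required by the definite description: the derivative at
    \<open>M\<close> is unique and the inner product is nondegenerate.\<close>
  have "G' = G" if "(f has_derivative frobenius_inner G') (at M)" for G'
  proof -
    have "frobenius_inner G' = frobenius_inner G"
      using has_derivative_unique[OF that d] G by simp
    then have "G' \<bullet> V = G \<bullet> V" for V
      by (metis frobenius_inner_eq_inner)
    then show ?thesis using vector_eq_rdot by blast
  qed
  then have "euc_gradient f M = G"
    unfolding euc_gradient_def using d[unfolded G] by (rule the_equality[rotated])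
  then show ?thesis using G by simp
qed

section \<open>Matrix algebra and the topology of \<open>GL\<close>\<close>

lemma matrix_add_rdistrib:
  fixes A B :: "'a::semiring_1^'n^'m"
  shows "(A + B) ** C = A ** C + B ** C"
  by (simp add: vec_eq_iff matrix_matrix_mult_def distrib_right sum.distrib)

lemma matrix_sub_ldistrib:
  fixes A :: "'a::ring_1^'n^'m"
  shows "A ** (B - C) = A ** B - A ** C"
  by (simp add: vec_eq_iff matrix_matrix_mult_def right_diff_distrib sum_subtractf)

lemma
  assumes "invertible A"
  shows matrix_inv_right: "A ** matrix_inv A = mat 1"
    and matrix_inv_left: "matrix_inv A ** A = mat 1"
  using someI_ex[OF assms[unfolded invertible_def]] unfolding matrix_inv_def by blast+

text \<open>The determinant is polynomial in the entries, hence continuous, and \<open>GL\<close> is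
  the preimage of the nonzero reals. Openness lets derivatives at \<open>M\<close> be computed from
  identities that hold only on \<open>GL\<close>.\<close>

lemma open_GL: "open (GL :: (real^'m^'m) set)"
proof -
  have "continuous_on UNIV (det :: real^'m^'m \<Rightarrow> real)"
    unfolding det_def by (intro continuous_intros)
  then have "open (det -` (- {0}) :: (real^'m^'m) set)"
    by (intro open_vimage) auto
  also have "det -` (- {0}) = (GL :: (real^'m^'m) set)"
    by (auto simp: GL_def invertible_det_nz)
  finally show ?thesis .
qed

section \<open>Left invariant fields, their brackets and their metric coefficients\<close>

lemma bounded_linear_left_invariant_field:
  "bounded_linear (left_invariant_field (A :: real^'m^'m))"
proof -
  have "linear (left_invariant_field A)"
    unfolding left_invariant_field_def
    by (rule linearI) (simp_all add: matrix_add_rdistrib scalar_matrix_assoc)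
  then show ?thesis by (rule linear_conv_bounded_linear[THEN iffD1])
qed

text \<open>Each field is linear in the point and so is its own derivative. Hence the derivative of
  the field of \<open>B\<close> in the direction \<open>p ** A\<close> is
  \<open>p ** A ** B\<close>.\<close>

lemma lie_bracket_left_invariant_field:
  fixes A B :: "real^'m^'m"
  shows "lie_bracket (left_invariant_field A) (left_invariant_field B)
    = left_invariant_field (commutator A B)"
proof -
  have "frechet_derivative (left_invariant_field C) (at p) = left_invariant_field C"
    for C p :: "real^'m^'m"
    using frechet_derivative_at[OF bounded_linear_imp_has_derivative
        [OF bounded_linear_left_invariant_field]] by metis
  then show ?thesis
    by (simp add: fun_eq_iff lie_bracket_def deriv_along_def left_invariant_field_def
        commutator_def matrix_mul_assoc matrix_sub_ldistrib)
qed

text \<open>The metric at \<open>M\<close> is the Frobenius product of the two vectors translated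
  back by \<open>matrix_inv M\<close>, and this translation cancels the factor
  \<open>M\<close>.\<close>

lemma inv_metric_left_mult:
  fixes M A B :: "real^'m^'m"
  assumes "M \<in> GL"
  shows "inv_metric M (M ** A) (M ** B) = A \<bullet> B"
proof -
  have "matrix_inv M ** M = mat 1"
    using assms unfolding GL_def by (simp add: matrix_inv_left)
  then have "matrix_inv M ** (M ** C) = C" for C :: "real^'m^'m"
    by (simp add: matrix_mul_assoc)
  moreover have "inv_metric M (M ** A) (M ** B) =
      frobenius_inner (matrix_inv M ** (M ** A)) (matrix_inv M ** (M ** B))"
    by (simp add: inv_metric_def frobenius_inner_def matrix_transpose_mul matrix_mul_assoc)
  ultimately show ?thesis by (simp add: frobenius_inner_eq_inner)
qed

text \<open>The Frobenius adjoint of ad B is ad of the transpose of B. For right multiplication this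
  rests on the cyclicity of the trace.\<close>

lemma inner_commutator:
  fixes A B C :: "real^'m^'m"
  shows "A \<bullet> commutator B C = commutator (transpose B) A \<bullet> C"
proof -
  have "A \<bullet> (B ** C) = (transpose B ** A) \<bullet> C"
    by (simp add: frobenius_inner_eq_inner[symmetric] frobenius_inner_def matrix_transpose_mul
        matrix_mul_assoc)
  moreover have "A \<bullet> (C ** B) = (A ** transpose B) \<bullet> C"
  proof -
    have "A \<bullet> (C ** B) = trace ((transpose A ** C) ** B)"
      by (simp add: frobenius_inner_eq_inner[symmetric] frobenius_inner_def matrix_mul_assoc)
    also have "\<dots> = trace (B ** (transpose A ** C))"
      by (rule trace_mul_sym)
    also have "\<dots> = (A ** transpose B) \<bullet> C"
      by (simp add: frobenius_inner_eq_inner[symmetric] frobenius_inner_def matrix_transpose_mul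
          matrix_mul_assoc)
    finally show ?thesis .
  qed
  ultimately show ?thesis
    by (simp add: commutator_def inner_diff_right inner_diff_left)
qed

section \<open>The covariant derivative and the Hessian along left invariant fields\<close>

lemma levi_civita_left_invariant_field:
  fixes A B M :: "real^'m^'m"
  assumes D: "levi_civita_connection GL inv_metric D" and M: "M \<in> GL"
  shows "D (left_invariant_field A) (left_invariant_field B) M =
    M ** ((1/2) *\<^sub>R (commutator A B - commutator (transpose B) A - commutator (transpose A) B))"
proof -
  \<comment> \<open>The covariant derivative translated back to the identity. The axioms for
    \<open>D\<close> then become algebraic identities for \<open>d\<close>.\<close>
  define d where
    "d A B = matrix_inv M ** D (left_invariant_field A) (left_invariant_field B) M" for A B
  have "M ** matrix_inv M = mat 1" "matrix_inv M ** M = mat 1"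
    using M unfolding GL_def by (simp_all add: matrix_inv_right matrix_inv_left)
  then have d: "D (left_invariant_field A) (left_invariant_field B) M = M ** d A B"
    and cancel: "matrix_inv M ** (M ** C) = C" for A B C
    by (simp_all add: d_def matrix_mul_assoc)
  have smooth: "smooth_on GL (left_invariant_field A)" for A :: "real^'m^'m"
    by (intro smooth_on_bounded_linear bounded_linear_left_invariant_field)
  \<comment> \<open>The metric coefficient \<open>?g\<close> equals \<open>B \<bullet> C\<close>
    throughout the open set \<open>GL\<close>, so its derivative vanishes and metric compatibility
    says that \<open>d A\<close> is skew-adjoint.\<close>
  have compat: "d A B \<bullet> C + B \<bullet> d A C = 0" for A B C
  proof -
    let ?g = "\<lambda>q. inv_metric q (left_invariant_field B q) (left_invariant_field C q)"
    have "(?g has_derivative (\<lambda>_. 0)) (at M)"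
      by (rule has_derivative_transform_within_open
          [OF has_derivative_const[of "B \<bullet> C"] open_GL M])
        (simp add: left_invariant_field_def inv_metric_left_mult)
    then have "deriv_along (left_invariant_field A) ?g M = 0"
      unfolding deriv_along_def by (simp add: frechet_derivative_at[symmetric])
    moreover have "deriv_along (left_invariant_field A) ?g M =
        inv_metric M (D (left_invariant_field A) (left_invariant_field B) M)
          (left_invariant_field C M) +
        inv_metric M (left_invariant_field B M)
          (D (left_invariant_field A) (left_invariant_field C) M)"
      using D[unfolded levi_civita_connection_def, THEN conjunct2, THEN conjunct2, rule_format,
          OF smooth smooth smooth M] .
    ultimately show ?thesis
      by (simp add: d left_invariant_field_def[of _ M] inv_metric_left_mult[OF M])
  qed
  have torsion: "d A B - d B A = commutator A B" for A B
  proof -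
    have "D (left_invariant_field A) (left_invariant_field B) M
        - D (left_invariant_field B) (left_invariant_field A) M = M ** commutator A B"
      using D[unfolded levi_civita_connection_def, THEN conjunct2, THEN conjunct1, rule_format,
          OF smooth smooth M]
      by (simp only: lie_bracket_left_invariant_field left_invariant_field_def[of _ M])
    then have "M ** (d A B - d B A) = M ** commutator A B"
      by (simp add: d matrix_sub_ldistrib)
    then show ?thesis by (metis cancel)
  qed
  let ?K = "commutator A B - commutator (transpose B) A - commutator (transpose A) B"
  have "(2 *\<^sub>R d A B) \<bullet> C = ?K \<bullet> C" for C
  proof -
    \<comment> \<open>The adjoint rule moves the transposes away, leaving only brackets of
      \<open>A\<close>, \<open>B\<close> and \<open>C\<close>, which torsion-freeness expresses by
      \<open>d\<close>.\<close>
    have "?K \<bullet> C = commutator A B \<bullet> C - A \<bullet> commutator B C - B \<bullet> commutator A C"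
      by (simp add: inner_commutator inner_diff_left)
    also have "\<dots> = (d A B - d B A) \<bullet> C - A \<bullet> (d B C - d C B) - B \<bullet> (d A C - d C A)"
      by (simp add: torsion)
    also have "\<dots> = (2 *\<^sub>R d A B) \<bullet> C"
      \<comment> \<open>Skewness of \<open>d B\<close> and of \<open>d C\<close> cancels four terms
        in pairs; skewness of \<open>d A\<close> turns \<open>- (B \<bullet> d A C)\<close> into a
        second copy of \<open>d A B \<bullet> C\<close>.\<close>
      using compat[of A B C] compat[of B A C] compat[of C A B]
      by (simp add: inner_diff_left inner_diff_right inner_commute)
    finally show ?thesis by simp
  qed
  then have "2 *\<^sub>R d A B = ?K"
    using vector_eq_rdot by blast
  then have "d A B = (1/2) *\<^sub>R ?K"
    by (metis scaleR_half_double scaleR_2 scaleR_scaleR scaleR_one)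
  then show ?thesis by (simp add: d)
qed

theorem theorem3p5:
  fixes n :: nat
    and f :: "real^'m^'m \<Rightarrow> real"
    and D :: "(real^'m^'m \<Rightarrow> real^'m^'m) \<Rightarrow> (real^'m^'m \<Rightarrow> real^'m^'m) \<Rightarrow> real^'m^'m \<Rightarrow> real^'m^'m"
    and X\<^sub>0 Y\<^sub>0 M :: "real^'m^'m"
  assumes "CARD('m) = 2 * n"
    and "smooth_on GL f"
    and "levi_civita_connection GL inv_metric D"
    and "M \<in> GL"
  shows "hessian D f (left_invariant_field X\<^sub>0) (left_invariant_field Y\<^sub>0) M =
         euc_hessian f M (M ** X\<^sub>0) (M ** Y\<^sub>0) +
         frobenius_inner (euc_gradient f M) (M ** Z_matrix X\<^sub>0 Y\<^sub>0)"
proof -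
  let ?f' = "frechet_derivative f (at M)"
  let ?N = "(1/2) *\<^sub>R (commutator X\<^sub>0 Y\<^sub>0 - commutator (transpose Y\<^sub>0) X\<^sub>0
    - commutator (transpose X\<^sub>0) Y\<^sub>0)"
  have f': "linear ?f'"
    using smooth_on_imp_has_derivative[OF assms(2,4)] has_derivative_linear by blast
  \<comment> \<open>The first-order term is df applied to the derivative of the field of
    \<open>Y\<^sub>0\<close> in the direction \<open>M ** X\<^sub>0\<close>, that is, to
    \<open>M ** X\<^sub>0 ** Y\<^sub>0\<close>.\<close>
  have "deriv_along (left_invariant_field X\<^sub>0) (deriv_along (left_invariant_field Y\<^sub>0) f) M =
      euc_hessian f M (M ** X\<^sub>0) (M ** Y\<^sub>0) + ?f' (M ** (X\<^sub>0 ** Y\<^sub>0))"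
    using deriv_along_deriv_along[OF open_GL assms(4,2) bounded_linear_imp_has_derivative
        [OF bounded_linear_left_invariant_field]]
    by (simp add: left_invariant_field_def[of _ M] left_invariant_field_def[of _ "M ** _"]
        matrix_mul_assoc)
  moreover have "deriv_along (D (left_invariant_field X\<^sub>0) (left_invariant_field Y\<^sub>0)) f M
      = ?f' (M ** ?N)"
    by (simp only: deriv_along_def levi_civita_left_invariant_field[OF assms(3,4)])
  \<comment> \<open>Subtracting half the commutator from \<open>X\<^sub>0 ** Y\<^sub>0\<close>
    leaves the symmetrized product, and the two commutators with transposes change sign.\<close>
  moreover have "X\<^sub>0 ** Y\<^sub>0 - ?N = Z_matrix X\<^sub>0 Y\<^sub>0"
  proof -
    have "X\<^sub>0 ** Y\<^sub>0 = (1/2) *\<^sub>R (X\<^sub>0 ** Y\<^sub>0 + X\<^sub>0 ** Y\<^sub>0)"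
      by simp
    then have "X\<^sub>0 ** Y\<^sub>0 - ?N = (1/2) *\<^sub>R (X\<^sub>0 ** Y\<^sub>0 + X\<^sub>0 ** Y\<^sub>0 - (commutator X\<^sub>0 Y\<^sub>0
        - commutator (transpose Y\<^sub>0) X\<^sub>0 - commutator (transpose X\<^sub>0) Y\<^sub>0))"
      by (metis scaleR_right_diff_distrib)
    then show ?thesis
      by (simp add: Z_matrix_def commutator_def[of X\<^sub>0] algebra_simps)
  qed
  moreover have "?f' (M ** (X\<^sub>0 ** Y\<^sub>0)) - ?f' (M ** ?N) = ?f' (M ** (X\<^sub>0 ** Y\<^sub>0 - ?N))"
    by (simp only: linear_diff[OF f'] matrix_sub_ldistrib)
  ultimately show ?thesis
    unfolding hessian_def
    using frobenius_inner_euc_gradient[OF smooth_on_imp_differentiable[OF assms(2,4)]]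
    by simp
qed

end
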